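(* There exists at least one $v^*\in W$ that minimises the functional $S:W\to\mathbb{R}$ over $W$. Moreover, any minimiser $v^*$ of $S$ over $W$ satisfies $\int_0^q v^*(t)\,dt=d$, hence lies in $V$.
   Context: Let $\alpha,\beta,v_{\max}>0$, $0\le v_0\le v_{\max}$, $d>0$ and $L\ge v_{\max}^2/(2\alpha)$ be constants, and let $q\in(0,\infty]$. Let $T\ge 0$ be a random variable with finite mean having a probability density $f$ that vanishes outside $[0,q)$, is bounded, and is strictly positive and non-increasing on $[0,q)$; let $F$ be its cumulative distribution function. Standing assumptions on $d$: if $q\ge v_0/\beta$ then $d\ge v_0^2/(2\beta)$; if $q<v_0/\beta$ then $d\ge q(v_0-q\beta/2)$. Moreover, if $q\le (v_{\max}-v_0)/\alpha$ then $d<q(v_0+q\alpha/2)$, and if $q\ge (v_{\max}-v_0)/\alpha$ then $d<\frac{(v_{\max}-v_0)(v_{\max}+v_0)}{2\alpha}+v_{\max}\bigl(q-\frac{v_{\max}-v_0}{\alpha}\bigr)$ (automatic if $q=\infty$). A function $g:[0,q)\to\mathbb{R}$ is $(\alpha,\beta)$-Lipschitz if $-\beta(t_2-t_1)\le g(t_2)-g(t_1)\le\alpha(t_2-t_1)$ for all $0\le t_1\le t_2<q$. $W$ is the set of $(\alpha,\beta)$-Lipschitz functions $v:[0,q)\to[0,v_{\max}]$ with $v(0)=v_0$ and $\int_0^q v(t)\,dt\le d$. $V\subseteq W$ is the subset of those with $\int_0^q v(t)\,dt=d$. Put $k(x,v)=\frac{1}{2\alpha v_{\max}}(v_{\max}-v)^2+\frac{1}{v_{\max}}(L-x)$,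 and for $v\in W$ define $$S(v)=\int_0^q\Bigl[t+k\Bigl(\int_0^t v(s)\,ds,\;v(t)\Bigr)\Bigr]f(t)\,dt .$$ *)

theory Defs
  imports "HOL-Probability.Probability"
begin

text \<open>The horizon \<open>q\<close> ranges over \<open>(0, \<infinity>]\<close>; since it may be infinite it is an extended real.\<close>

definition horizon :: "ereal \<Rightarrow> real set" where
  "horizon q = {t. 0 \<le> t \<and> ereal t < q}"

definition lipschitz_ab :: "real \<Rightarrow> real \<Rightarrow> ereal \<Rightarrow> (real \<Rightarrow> real) \<Rightarrow> bool" where
  "lipschitz_ab \<alpha> \<beta> q g \<longleftrightarrow>
     (\<forall>t1 t2. 0 \<le> t1 \<and> t1 \<le> t2 \<and> ereal t2 < q \<longrightarrow>
        - \<beta> * (t2 - t1) \<le> g t2 - g t1 \<and> g t2 - g t1 \<le> \<alpha> * (t2 - t1))"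

text \<open>
  Functions \<open>[0,q) \<rightarrow> [0,vmax]\<close> are represented extensionally (value \<open>undefined\<close> outside \<open>[0,q)\<close>).
  Integrability is demanded explicitly: for \<open>q = \<infinity>\<close> the integral of a nonnegative \<open>v\<close> can be infinite,
  which violates the bound \<open>d\<close>, whereas the Bochner integral would then default to \<open>0\<close>.
\<close>

definition W_set :: "real \<Rightarrow> real \<Rightarrow> real \<Rightarrow> real \<Rightarrow> real \<Rightarrow> ereal \<Rightarrow> (real \<Rightarrow> real) set" where
  "W_set \<alpha> \<beta> vmax v0 d q =
     {v \<in> horizon q \<rightarrow>\<^sub>E {0..vmax}.
        lipschitz_ab \<alpha> \<beta> q v \<and> v 0 = v0 \<and>
        interval_lebesgue_integrable lborel 0 q v \<and> (LBINT t=0..q. v t) \<le> d}"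

definition V_set :: "real \<Rightarrow> real \<Rightarrow> real \<Rightarrow> real \<Rightarrow> real \<Rightarrow> ereal \<Rightarrow> (real \<Rightarrow> real) set" where
  "V_set \<alpha> \<beta> vmax v0 d q = {v \<in> W_set \<alpha> \<beta> vmax v0 d q. (LBINT t=0..q. v t) = d}"

definition k_cost :: "real \<Rightarrow> real \<Rightarrow> real \<Rightarrow> real \<Rightarrow> real \<Rightarrow> real" where
  "k_cost \<alpha> vmax L x v = 1 / (2 * \<alpha> * vmax) * (vmax - v)\<^sup>2 + 1 / vmax * (L - x)"

text \<open>
  On \<open>W_set\<close> the integrand below is integrable whenever \<open>f\<close> is the density of a nonnegative random
  variable with finite mean, because the cost \<open>k\<close> is then bounded along \<open>v\<close>.
\<close>

definition S_fun :: "real \<Rightarrow> real \<Rightarrow> real \<Rightarrow> ereal \<Rightarrow> (real \<Rightarrow> real) \<Rightarrow> (real \<Rightarrow> real) \<Rightarrow> real" where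
  "S_fun \<alpha> vmax L q f v =
     (LBINT t=0..q. (t + k_cost \<alpha> vmax L (LBINT s=0..ereal t. v s) (v t)) * f t)"

end

(* Existence is the direct method: uniformly Lipschitz functions have pointwise convergent
   subsequences, Fatou's lemma keeps the constraint on the distance, and since the cost k is
   bounded along W while T has finite mean, dominated convergence makes S continuous.

   The constraint is active because S strictly decreases when v is raised. If v is in W with
   distance below d, the upper bounds on d forbid v(t) = min vmax (v0 + \<alpha> t) throughout, so v lies
   strictly below this curve at some t0. The maximum of v and a peak at t0, slightly higher than
   v(t0), with slopes \<alpha> and -\<beta>, is again in W and has smaller cost; the peak is positive
   only on a bounded interval, so this works for q = \<infinity> as well. *)

theory Submission
  imports Defs "HOL-Complex_Analysis.Great_Picard"
begin

section \<open>The horizon and asymmetric Lipschitz functions\<close>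

lemma horizon_eq_insert: "q > 0 \<Longrightarrow> horizon q = insert 0 (einterval 0 q)"
  by (auto simp: horizon_def einterval_iff zero_ereal_def order_le_less)

lemma sets_horizon [measurable]: "horizon q \<in> sets borel"
  unfolding horizon_def by measurable

text \<open>Forgetting the asymmetry of the two slopes gives access to continuity, and to the
  equicontinuity behind compactness.\<close>

lemma lipschitz_ab_imp_lipschitz_on:
  assumes "lipschitz_ab \<alpha> \<beta> q g" "\<alpha> > 0" "\<beta> > 0"
  shows "(max \<alpha> \<beta>)-lipschitz_on (horizon q) g"
proof (rule lipschitz_onI)
  have *: "\<bar>g t - g s\<bar> \<le> max \<alpha> \<beta> * (t - s)" if "s \<in> horizon q" "t \<in> horizon q" "s \<le> t" for s t
  proof -
    have "- \<beta> * (t - s) \<le> g t - g s" "g t - g s \<le> \<alpha> * (t - s)"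
      using that assms(1) by (auto simp: lipschitz_ab_def horizon_def)
    moreover have "\<alpha> * (t - s) \<le> max \<alpha> \<beta> * (t - s)" "\<beta> * (t - s) \<le> max \<alpha> \<beta> * (t - s)"
      using that by (auto intro!: mult_right_mono)
    ultimately show ?thesis by (simp add: abs_le_iff)
  qed
  show "dist (g s) (g t) \<le> max \<alpha> \<beta> * dist s t" if "s \<in> horizon q" "t \<in> horizon q" for s t
    using *[of s t] *[of t s] that by (cases "s \<le> t") (auto simp: dist_real_def abs_minus_commute)
  show "0 \<le> max \<alpha> \<beta>" using assms by simp
qed

lemma lipschitz_ab_max:
  assumes "lipschitz_ab \<alpha> \<beta> q g" "lipschitz_ab \<alpha> \<beta> q h"
  shows "lipschitz_ab \<alpha> \<beta> q (\<lambda>t. max (g t) (h t))"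
  using assms unfolding lipschitz_ab_def by (smt (verit))

lemma lipschitz_ab_cong:
  assumes "\<And>t. t \<in> horizon q \<Longrightarrow> g t = h t"
  shows "lipschitz_ab \<alpha> \<beta> q g \<longleftrightarrow> lipschitz_ab \<alpha> \<beta> q h"
proof -
  have "g t = h t" if "0 \<le> t" "ereal t < q" for t
    using assms that by (auto simp: horizon_def)
  moreover have "ereal s < q" if "s \<le> t" "ereal t < q" for s t
    using that by (meson ereal_less_eq(3) le_less_trans)
  ultimately show ?thesis
    unfolding lipschitz_ab_def by (smt (verit))
qed

section \<open>Distances travelled under constant acceleration\<close>

lemma has_bochner_integral_affine:
  fixes a b T :: real
  assumes "0 \<le> T"
  shows "has_bochner_integral lborel (\<lambda>t. (a + b * t) * indicator {0..T} t) (T * (a + T * b / 2))"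
proof -
  have "has_bochner_integral lborel (\<lambda>t. (a + b * t) * indicator {0..T} t)
      ((a * T + b * T^2 / 2) - (a * 0 + b * 0^2 / 2))"
    by (rule has_bochner_integral_FTC_Icc_real[OF assms])
       (auto intro!: derivative_eq_intros continuous_intros)
  then show ?thesis by (simp add: algebra_simps power2_eq_square)
qed

text \<open>The integral splits at the time when full acceleration reaches \<open>vmax\<close>: an
  affine ramp, then cruising at constant speed. With \<open>T = q\<close> the value is the upper
  bound on \<open>d\<close> for a long horizon.\<close>

lemma has_bochner_integral_min_affine:
  fixes \<alpha> vmax v0 T :: real
  assumes "\<alpha> > 0" "v0 \<le> vmax" "(vmax - v0) / \<alpha> \<le> T"
  shows "has_bochner_integral lborel (\<lambda>t. min vmax (v0 + \<alpha> * t) * indicator {0..T} t)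
           ((vmax - v0) * (vmax + v0) / (2 * \<alpha>) + vmax * (T - (vmax - v0) / \<alpha>))"
proof -
  define \<tau> where "\<tau> = (vmax - v0) / \<alpha>"
  have \<tau>: "0 \<le> \<tau>" "\<tau> \<le> T" "\<alpha> * \<tau> = vmax - v0"
    using assms by (auto simp: \<tau>_def)
  \<comment> \<open>The cruising interval leaves out \<open>\<tau>\<close>, so that the two pieces
    do not overlap there.\<close>
  have "has_bochner_integral lborel (\<lambda>t. indicator {\<tau><..T} t *\<^sub>R vmax) (measure lborel {\<tau><..T} *\<^sub>R vmax)"
    by (rule has_bochner_integral_indicator) (use \<tau> in auto)
  then have "has_bochner_integral lborel
      (\<lambda>t. (v0 + \<alpha> * t) * indicator {0..\<tau>} t + indicator {\<tau><..T} t *\<^sub>R vmax)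
      (\<tau> * (v0 + \<tau> * \<alpha> / 2) + measure lborel {\<tau><..T} *\<^sub>R vmax)"
    by (intro has_bochner_integral_add has_bochner_integral_affine \<tau>)
  moreover have "(v0 + \<alpha> * t) * indicator {0..\<tau>} t + indicator {\<tau><..T} t *\<^sub>R vmax
      = min vmax (v0 + \<alpha> * t) * indicator {0..T} t" for t
    using \<tau> assms(1) mult_le_cancel_left_pos[of \<alpha> t \<tau>] mult_le_cancel_left_pos[of \<alpha> \<tau> t]
    by (auto split: split_indicator simp: min_def)
  moreover have "\<tau> * (v0 + \<tau> * \<alpha> / 2) = (vmax - v0) * (vmax + v0) / (2 * \<alpha>)"
  proof -
    have "\<tau> * (v0 + \<tau> * \<alpha> / 2) = \<tau> * ((vmax + v0) / 2)"
      using \<tau>(3) by (simp add: mult.commute[of \<tau> \<alpha>] add_divide_distrib diff_divide_distrib)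
    then show ?thesis by (simp add: \<tau>_def field_simps)
  qed
  ultimately show ?thesis
    using \<tau>(2) by (simp add: \<tau>_def[symmetric] mult.commute)
qed

section \<open>The optimisation problem on the whole real line\<close>

locale speed_problem =
  fixes \<alpha> \<beta> vmax v0 d L :: real and q :: ereal and f :: "real \<Rightarrow> real"
  assumes \<alpha>_pos: "\<alpha> > 0" and \<beta>_pos: "\<beta> > 0" and vmax_pos: "vmax > 0"
    and v0_nonneg: "0 \<le> v0" and v0_le: "v0 \<le> vmax" and q_pos: "q > 0"
    and f_off: "\<And>t. t \<notin> horizon q \<Longrightarrow> f t = 0"
    and f_pos: "\<And>t. t \<in> horizon q \<Longrightarrow> f t > 0"
    and f_integrable: "integrable lborel f"
    and f_moment: "integrable lborel (\<lambda>t. t * f t)"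
begin

abbreviation "W \<equiv> W_set \<alpha> \<beta> vmax v0 d q"
abbreviation "S \<equiv> S_fun \<alpha> vmax L q f"

text \<open>Extension by \<open>0\<close>, since members of \<open>W\<close> are \<open>undefined\<close> off the horizon.\<close>

definition ext :: "(real \<Rightarrow> real) \<Rightarrow> real \<Rightarrow> real" where
  "ext v t = indicator (horizon q) t * v t"

text \<open>The open interval is the one that \<open>LBINT\<close> from \<open>0\<close> to
  \<open>t\<close> integrates over when \<open>0 \<le> t\<close>. For \<open>t \<le> 0\<close> the
  value is \<open>0\<close>, so for admissible \<open>v\<close> the function is monotone on the
  whole line.\<close>

definition position :: "(real \<Rightarrow> real) \<Rightarrow> real \<Rightarrow> real" where
  "position v t = (\<integral>s. indicator {0<..<t} s * ext v s \<partial>lborel)"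

definition cost :: "(real \<Rightarrow> real) \<Rightarrow> real \<Rightarrow> real" where
  "cost v t = t + k_cost \<alpha> vmax L (position v t) (ext v t)"

text \<open>Bounds \<open>k_cost\<close> along every member of \<open>W\<close>: the first summand
  for speeds in \<open>[0, vmax]\<close>, the second for positions in \<open>[0, d]\<close>.\<close>

definition cost_bound :: real where
  "cost_bound = vmax / (2 * \<alpha>) + (\<bar>L\<bar> + d) / vmax"

lemma f_measurable [measurable]: "f \<in> borel_measurable borel"
  using f_integrable by simp

lemma f_nonneg: "0 \<le> f t"
  using f_off[of t] f_pos[of t] by (cases "t \<in> horizon q") auto

lemma f_zero_neg: "t < 0 \<Longrightarrow> f t = 0"
  by (rule f_off) (auto simp: horizon_def)

lemma zero_in_horizon: "0 \<in> horizon q"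
  using q_pos by (simp add: horizon_def zero_ereal_def)

lemma horizon_less: "s \<in> horizon q" if "t \<in> horizon q" "0 \<le> s" "s \<le> t"
  using that by (auto simp: horizon_def) (meson ereal_less_eq(3) le_less_trans)

text \<open>Interval integrals run over the open interval \<open>einterval 0 q\<close>, which misses
  only the null set \<open>{0}\<close> of the horizon.\<close>

lemma interval_integral_eq: "(LBINT t=0..q. g t) = (\<integral>t. indicator (horizon q) t * g t \<partial>lborel)"
  for g :: "real \<Rightarrow> real"
proof -
  have "(LBINT t=0..q. g t) = (\<integral>t. indicator (einterval 0 q) t * g t \<partial>lborel)"
    using q_pos by (simp add: interval_lebesgue_integral_def set_lebesgue_integral_def order_less_imp_le)
  also have "\<dots> = (\<integral>t. indicator (horizon q) t * g t \<partial>lborel)"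
    by (rule integral_discrete_difference[where X="{0}"])
       (auto simp: horizon_eq_insert[OF q_pos] split: split_indicator)
  finally show ?thesis .
qed

lemma interval_integrable_iff:
  "interval_lebesgue_integrable lborel 0 q g \<longleftrightarrow> integrable lborel (\<lambda>t. indicator (horizon q) t * g t)"
  for g :: "real \<Rightarrow> real"
proof -
  have "interval_lebesgue_integrable lborel 0 q g \<longleftrightarrow>
      integrable lborel (\<lambda>t. indicator (einterval 0 q) t * g t)"
    using q_pos by (simp add: interval_lebesgue_integrable_def set_integrable_def order_less_imp_le)
  also have "\<dots> \<longleftrightarrow> integrable lborel (\<lambda>t. indicator (horizon q) t * g t)"
    by (rule integrable_discrete_difference[where X="{0}"])
       (auto simp: horizon_eq_insert[OF q_pos] split: split_indicator)
  finally show ?thesis .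
qed

lemma in_W_iff:
  "v \<in> W \<longleftrightarrow> v \<in> horizon q \<rightarrow>\<^sub>E {0..vmax} \<and> lipschitz_ab \<alpha> \<beta> q v \<and> v 0 = v0 \<and>
     integrable lborel (ext v) \<and> integral\<^sup>L lborel (ext v) \<le> d"
  by (simp add: W_set_def interval_integral_eq interval_integrable_iff ext_def[abs_def])

lemma ext_measurable:
  assumes "lipschitz_ab \<alpha> \<beta> q v"
  shows "ext v \<in> borel_measurable borel"
proof -
  have "continuous_on (horizon q) v"
    by (rule lipschitz_on_continuous_on[OF lipschitz_ab_imp_lipschitz_on[OF assms \<alpha>_pos \<beta>_pos]])
  from borel_measurable_continuous_on_indicator[OF sets_horizon this] show ?thesis
    by (simp add: ext_def[abs_def])
qed

text \<open>Membership test for the functions constructed below: one integrable majorant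
  \<open>g\<close> settles both integrability and the bound on the distance.\<close>

lemma W_restrictI:
  assumes lip: "lipschitz_ab \<alpha> \<beta> q v" and range: "\<And>t. t \<in> horizon q \<Longrightarrow> 0 \<le> v t \<and> v t \<le> vmax"
    and "v 0 = v0" and g: "integrable lborel g" "\<And>t. ext v t \<le> g t" "integral\<^sup>L lborel g \<le> d"
  shows "restrict v (horizon q) \<in> W"
proof -
  have ext: "ext (restrict v (horizon q)) = ext v"
    by (auto simp: ext_def fun_eq_iff split: split_indicator)
  have nn: "0 \<le> ext v t" for t using range by (auto simp: ext_def split: split_indicator)
  have int: "integrable lborel (ext v)"
    by (rule Bochner_Integration.integrable_bound[OF g(1)])
       (use nn ext_measurable[OF lip] in \<open>auto intro: order_trans[OF g(2) abs_ge_self]\<close>)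
  moreover have "integral\<^sup>L lborel (ext v) \<le> d"
    using integral_mono[OF int g(1) g(2)] g(3) by simp
  moreover have "lipschitz_ab \<alpha> \<beta> q (restrict v (horizon q))"
    using lip by (subst lipschitz_ab_cong[of q _ v]) auto
  ultimately show ?thesis
    using range zero_in_horizon \<open>v 0 = v0\<close> by (auto simp: in_W_iff ext)
qed

section \<open>Bounds and measurability along an admissible function\<close>

context
  fixes v assumes v: "v \<in> W"
begin

lemma W_range: "t \<in> horizon q \<Longrightarrow> 0 \<le> v t" "t \<in> horizon q \<Longrightarrow> v t \<le> vmax"
  using v by (auto simp: in_W_iff PiE_iff)

lemma ext_bounds: "0 \<le> ext v t" "ext v t \<le> vmax"
  using W_range vmax_pos by (auto simp: ext_def split: split_indicator)

lemma ext_integrable: "integrable lborel (ext v)"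
  using v by (simp add: in_W_iff)

lemma position_integrable: "integrable lborel (\<lambda>s. indicator {0<..<t} s * ext v s)"
  using integrable_mult_indicator[OF _ ext_integrable, of "{0<..<t}"] by simp

lemma position_bounds: "0 \<le> position v t" "position v t \<le> d"
proof -
  show "0 \<le> position v t"
    unfolding position_def using ext_bounds by (intro integral_nonneg_AE) auto
  have "position v t \<le> integral\<^sup>L lborel (ext v)"
    unfolding position_def
    by (rule integral_mono[OF position_integrable ext_integrable])
       (use ext_bounds in \<open>auto split: split_indicator\<close>)
  then show "position v t \<le> d" using v by (simp add: in_W_iff)
qed

lemma position_measurable: "position v \<in> borel_measurable borel"
proof (rule borel_measurable_mono, rule monoI)
  fix s t :: real assume "s \<le> t"
  then show "position v s \<le> position v t"
    unfolding position_def
    by (intro integral_mono[OF position_integrable position_integrable])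
       (use ext_bounds in \<open>auto split: split_indicator\<close>)
qed

text \<open>Off the horizon \<open>f\<close> vanishes, so the values of \<open>cost\<close> there do
  not matter and the integral may extend over the whole line.\<close>

lemma S_eq_integral_cost: "S v = (\<integral>t. cost v t * f t \<partial>lborel)"
proof -
  have "(LBINT s=0..ereal t. v s) = position v t" if "t \<in> horizon q" for t
  proof -
    have "0 \<le> t" using that by (simp add: horizon_def)
    then have "(LBINT s=0..ereal t. v s) = (\<integral>s. indicator {0<..<t} s * v s \<partial>lborel)"
      by (simp add: interval_lebesgue_integral_def set_lebesgue_integral_def zero_ereal_def)
    also have "\<dots> = position v t"
      unfolding position_def ext_def
      using horizon_less[OF that] by (intro Bochner_Integration.integral_cong) (auto split: split_indicator)
    finally show ?thesis .
  qed
  then show ?thesis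
    unfolding S_fun_def interval_integral_eq cost_def
    by (intro Bochner_Integration.integral_cong) (auto simp: ext_def f_off split: split_indicator)
qed

text \<open>The right-hand side does not depend on \<open>v\<close>. This uniformity gives
  integrability of the cost, a lower bound for \<open>S\<close> and the domination in the limit
  argument.\<close>

lemma abs_cost_le: "\<bar>cost v t * f t\<bar> \<le> t * f t + cost_bound * f t"
proof (cases "t < 0")
  case False
  have "(vmax - ext v t)\<^sup>2 \<le> vmax\<^sup>2"
    using ext_bounds[of t] by (intro power_mono) auto
  then have "1 / (2 * \<alpha> * vmax) * (vmax - ext v t)\<^sup>2 \<le> 1 / (2 * \<alpha> * vmax) * vmax\<^sup>2"
    using \<alpha>_pos vmax_pos by (intro mult_left_mono) auto
  also have "\<dots> = vmax / (2 * \<alpha>)"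
    using vmax_pos by (simp add: power2_eq_square)
  finally have 1: "1 / (2 * \<alpha> * vmax) * (vmax - ext v t)\<^sup>2 \<le> vmax / (2 * \<alpha>)" .
  have 2: "0 \<le> 1 / (2 * \<alpha> * vmax) * (vmax - ext v t)\<^sup>2"
    using \<alpha>_pos vmax_pos by simp
  have 3: "\<bar>1 / vmax * (L - position v t)\<bar> \<le> (\<bar>L\<bar> + d) / vmax"
    using position_bounds[of t] vmax_pos by (auto simp: abs_mult divide_right_mono)
  have "\<bar>cost v t\<bar> \<le> t + cost_bound"
    using 1 2 3 False unfolding cost_def k_cost_def cost_bound_def by linarith
  then show ?thesis
    using mult_right_mono[of "\<bar>cost v t\<bar>" "t + cost_bound" "f t"] f_nonneg[of t]
    by (simp add: abs_mult distrib_right)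
qed (simp add: f_zero_neg)

lemma cost_measurable: "(\<lambda>t. cost v t * f t) \<in> borel_measurable borel"
proof -
  have [measurable]: "position v \<in> borel_measurable borel" "ext v \<in> borel_measurable borel"
    using position_measurable ext_integrable by auto
  show ?thesis unfolding cost_def k_cost_def by measurable
qed

end

section \<open>Lower bound and continuity of the functional\<close>

lemma dominating_integrable: "integrable lborel (\<lambda>t. t * f t + cost_bound * f t)"
  using f_moment f_integrable by auto

lemma cost_integrable:
  assumes "v \<in> W"
  shows "integrable lborel (\<lambda>t. cost v t * f t)"
proof (rule Bochner_Integration.integrable_bound[OF dominating_integrable])
  show "AE t in lborel. norm (cost v t * f t) \<le> norm (t * f t + cost_bound * f t)"
    using order_trans[OF abs_cost_le[OF assms] abs_ge_self] by simp
qed (use cost_measurable[OF assms] in simp)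

lemma S_bounded_below: "bdd_below (S ` W)"
proof (rule bdd_belowI2)
  fix v assume v: "v \<in> W"
  have "- (\<integral>t. t * f t + cost_bound * f t \<partial>lborel) = (\<integral>t. - (t * f t + cost_bound * f t) \<partial>lborel)"
    by (rule Bochner_Integration.integral_minus[symmetric])
  also have "\<dots> \<le> S v"
    unfolding S_eq_integral_cost[OF v]
  proof (intro integral_mono integrable_minus dominating_integrable cost_integrable[OF v])
    show "- (t * f t + cost_bound * f t) \<le> cost v t * f t" for t
      using abs_cost_le[OF v, of t] by linarith
  qed
  finally show "- (\<integral>t. t * f t + cost_bound * f t \<partial>lborel) \<le> S v" .
qed

text \<open>Dominated convergence is applied twice: to positions at a fixed time, where speeds are
  at most \<open>vmax\<close> on a bounded interval, and then to the cost. Convergence of the total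
  distances is not claimed: for \<open>q = \<infinity>\<close> part of the distance may escape to
  infinity.\<close>

lemma S_continuous:
  assumes u: "\<And>n. u n \<in> W" and v: "v \<in> W"
    and lim: "\<And>t. t \<in> horizon q \<Longrightarrow> (\<lambda>n. u n t) \<longlonglongrightarrow> v t"
  shows "(\<lambda>n. S (u n)) \<longlonglongrightarrow> S v"
proof -
  have ext: "(\<lambda>n. ext (u n) t) \<longlonglongrightarrow> ext v t" for t
    using lim[of t] by (auto simp: ext_def split: split_indicator)
  have pos: "(\<lambda>n. position (u n) t) \<longlonglongrightarrow> position v t" for t
    unfolding position_def
  proof (rule integral_dominated_convergence[where w="\<lambda>s. vmax * indicator {0<..<t} s"])
    show "AE s in lborel. norm (indicator {0<..<t} s * ext (u n) s) \<le> vmax * indicator {0<..<t} s" for n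
      using ext_bounds[OF u] by (auto split: split_indicator)
    show "AE s in lborel. (\<lambda>n. indicator {0<..<t} s * ext (u n) s) \<longlonglongrightarrow> indicator {0<..<t} s * ext v s"
      by (auto intro!: tendsto_intros ext)
    show "integrable lborel (\<lambda>s. vmax * indicator {0<..<t} s)"
      by (intro integrable_mult_right integrable_real_indicator; cases "0 \<le> t") auto
  qed (intro borel_measurable_integrable position_integrable u v)+
  have cost: "(\<lambda>n. cost (u n) t) \<longlonglongrightarrow> cost v t" for t
    unfolding cost_def k_cost_def by (intro tendsto_intros ext pos)
  show ?thesis
    unfolding S_eq_integral_cost[OF u] S_eq_integral_cost[OF v]
  proof (rule integral_dominated_convergence[OF _ _ dominating_integrable])
    show "AE t in lborel. (\<lambda>n. cost (u n) t * f t) \<longlonglongrightarrow> cost v t * f t"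
      by (auto intro!: tendsto_intros cost)
  qed (use cost_measurable[OF u] cost_measurable[OF v] abs_cost_le[OF u] in auto)
qed

section \<open>Compactness and existence of a minimiser\<close>

text \<open>An Arzela-Ascoli argument: a subsequence converges at the rational points, and the
  common Lipschitz constant spreads convergence to the whole horizon. Range and slope bounds are
  closed conditions. Distance can be lost in the limit but not gained, so the constraint must be an
  inequality here.\<close>

lemma W_sequentially_compact:
  assumes u: "\<And>n. u n \<in> W"
  obtains r v where "strict_mono (r :: nat \<Rightarrow> nat)" "v \<in> W"
    "\<And>t. t \<in> horizon q \<Longrightarrow> (\<lambda>n. u (r n) t) \<longlonglongrightarrow> v t"
proof -
  define K where "K = max \<alpha> \<beta>"
  have K: "0 < K" using \<alpha>_pos by (simp add: K_def)
  have lip: "\<bar>u n s - u n t\<bar> \<le> K * \<bar>s - t\<bar>" if "s \<in> horizon q" "t \<in> horizon q" for n s t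
    using lipschitz_onD[OF lipschitz_ab_imp_lipschitz_on[of \<alpha> \<beta> q "u n"] that] u[of n] \<alpha>_pos \<beta>_pos
    by (simp add: in_W_iff K_def dist_real_def)
  obtain r where r: "strict_mono (r :: nat \<Rightarrow> nat)"
    and conv: "\<And>x. x \<in> \<rat> \<inter> horizon q \<Longrightarrow> \<exists>l. (\<lambda>n. u (r n) x) \<longlonglongrightarrow> l"
  proof -
    have "countable (\<rat> \<inter> horizon q)" using countable_rat by blast
    moreover have "norm (u n x) \<le> vmax" if "x \<in> \<rat> \<inter> horizon q" for n x
      using W_range[OF u, of x n] that by simp
    ultimately show thesis
      by (rule function_convergent_subsequence[of _ u vmax]) (use that in blast)+
  qed
  have "convergent (\<lambda>n. u (r n) t)" if t: "t \<in> horizon q" for t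
  proof (rule Cauchy_convergent, rule metric_CauchyI)
    fix e :: real assume e: "0 < e"
    \<comment> \<open>Approximating \<open>t\<close> from the right works at \<open>t = 0\<close>
      too; \<open>b\<close> keeps the rational point below \<open>q\<close>.\<close>
    obtain b where b: "t < b" "ereal b < q"
      using t lt_ex ereal_dense2[of "ereal t" q] by (auto simp: horizon_def)
    \<comment> \<open>At distance at most \<open>e / (3 * K)\<close>, passing from \<open>t\<close>
      to \<open>x\<close> costs at most \<open>e / 3\<close>. This happens twice, and the Cauchy
      property at \<open>x\<close> supplies the last third.\<close>
    have "t < min b (t + e / (3 * K))" using b e K by simp
    then obtain x where x: "x \<in> \<rat>" "t < x" "x < min b (t + e / (3 * K))"
      using Rats_dense_in_real by blast
    then have xH: "x \<in> horizon q"
      using b t by (auto simp: horizon_def intro: less_trans[of "ereal x" "ereal b" q])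
    have near: "\<bar>u n t - u n x\<bar> \<le> e / 3" for n
    proof -
      have "\<bar>u n t - u n x\<bar> \<le> K * \<bar>t - x\<bar>" by (rule lip[OF t xH])
      also have "\<dots> \<le> K * (e / (3 * K))" using x K by (intro mult_left_mono) auto
      finally show ?thesis using K by simp
    qed
    have "Cauchy (\<lambda>n. u (r n) x)"
      using conv[of x] x xH by (auto intro: LIMSEQ_imp_Cauchy)
    then obtain N where N: "\<And>m n. m \<ge> N \<Longrightarrow> n \<ge> N \<Longrightarrow> dist (u (r m) x) (u (r n) x) < e / 3"
      using e unfolding Cauchy_def by (meson divide_pos_pos zero_less_numeral)
    have "dist (u (r m) t) (u (r n) t) < e" if "m \<ge> N" "n \<ge> N" for m n
      using N[OF that] near[of "r m"] near[of "r n"] 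
      unfolding dist_real_def abs_less_iff abs_le_iff by linarith
    then show "\<exists>N. \<forall>m\<ge>N. \<forall>n\<ge>N. dist (u (r m) t) (u (r n) t) < e" by blast
  qed
  then have lim: "\<exists>l. (\<lambda>n. u (r n) t) \<longlonglongrightarrow> l" if "t \<in> horizon q" for t
    using that by (simp add: convergent_def)
  define v where "v = restrict (\<lambda>t. lim (\<lambda>n. u (r n) t)) (horizon q)"
  have v: "(\<lambda>n. u (r n) t) \<longlonglongrightarrow> v t" if "t \<in> horizon q" for t
    using lim[OF that] that by (auto simp: v_def limI)
  have range: "0 \<le> v t \<and> v t \<le> vmax" if "t \<in> horizon q" for t
    using LIMSEQ_le_const[OF v[OF that]] LIMSEQ_le_const2[OF v[OF that]] W_range[OF u that] by blast
  have lip_v: "lipschitz_ab \<alpha> \<beta> q v"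
    unfolding lipschitz_ab_def
  proof (intro allI impI)
    fix s t assume st: "0 \<le> s \<and> s \<le> t \<and> ereal t < q"
    then have H: "t \<in> horizon q" "s \<in> horizon q"
      using horizon_less[of t s] by (auto simp: horizon_def)
    have diff: "(\<lambda>n. u (r n) t - u (r n) s) \<longlonglongrightarrow> v t - v s"
      by (intro tendsto_diff v H)
    have "- \<beta> * (t - s) \<le> u n t - u n s \<and> u n t - u n s \<le> \<alpha> * (t - s)" for n
      using u[of n] st by (auto simp: in_W_iff lipschitz_ab_def)
    then show "- \<beta> * (t - s) \<le> v t - v s \<and> v t - v s \<le> \<alpha> * (t - s)"
      using LIMSEQ_le_const[OF diff] LIMSEQ_le_const2[OF diff] by blast
  qed
  have v0: "v 0 = v0"
    using v[OF zero_in_horizon] u by (simp add: in_W_iff LIMSEQ_const_iff)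
  have nn: "0 \<le> ext v t" for t using range by (auto simp: ext_def split: split_indicator)
  \<comment> \<open>Fatou's lemma works with nonnegative integrals, so it yields integrability of
    the limit together with the bound \<open>d\<close>.\<close>
  have "(\<integral>\<^sup>+t. ennreal (ext v t) \<partial>lborel) = (\<integral>\<^sup>+t. liminf (\<lambda>n. ennreal (ext (u (r n)) t)) \<partial>lborel)"
  proof (intro nn_integral_cong)
    fix t
    have "(\<lambda>n. ext (u (r n)) t) \<longlonglongrightarrow> ext v t"
      using v[of t] by (auto simp: ext_def split: split_indicator)
    then show "ennreal (ext v t) = liminf (\<lambda>n. ennreal (ext (u (r n)) t))"
      by (intro lim_imp_Liminf[symmetric] tendsto_ennrealI) auto
  qed
  also have "\<dots> \<le> liminf (\<lambda>n. \<integral>\<^sup>+t. ennreal (ext (u (r n)) t) \<partial>lborel)"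
    using ext_integrable[OF u] by (intro nn_integral_liminf) auto
  also have "\<dots> \<le> liminf (\<lambda>n. ennreal d)"
  proof (intro Liminf_mono always_eventually allI)
    fix n
    have "(\<integral>\<^sup>+t. ennreal (ext (u (r n)) t) \<partial>lborel) = ennreal (integral\<^sup>L lborel (ext (u (r n))))"
      by (rule nn_integral_eq_integral[OF ext_integrable[OF u]]) (simp add: ext_bounds[OF u])
    also have "\<dots> \<le> ennreal d"
      using u[of "r n"] by (simp add: in_W_iff ennreal_leI)
    finally show "(\<integral>\<^sup>+t. ennreal (ext (u (r n)) t) \<partial>lborel) \<le> ennreal d" .
  qed
  also have "\<dots> = ennreal d" by (simp add: Liminf_const)
  finally have le: "(\<integral>\<^sup>+t. ennreal (ext v t) \<partial>lborel) \<le> ennreal d" .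
  have "integrable lborel (ext v)"
    using nn le ext_measurable[OF lip_v] by (intro integrableI_nonneg) (auto intro: le_less_trans)
  \<comment> \<open>The sign of \<open>d\<close>, required for turning the \<open>ennreal\<close>
    bound into a real one, follows from the position of \<open>u 0\<close> lying between
    \<open>0\<close> and \<open>d\<close>.\<close>
  moreover have "0 \<le> d"
    using position_bounds[OF u, of 0 0] by linarith
  then have "integral\<^sup>L lborel (ext v) \<le> d"
    by (rule integral_real_bounded[OF _ le])
  ultimately have "v \<in> W"
    using range lip_v v0 by (auto simp: in_W_iff v_def)
  from that[OF r this v] show thesis .
qed

text \<open>A minimising sequence has a subsequence with limit in \<open>W\<close>, and continuity
  of \<open>S\<close> makes its value there the infimum \<open>m\<close>.\<close>

lemma minimiser_exists:
  assumes "W \<noteq> {}"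
  shows "\<exists>v. is_arg_min S (\<lambda>v. v \<in> W) v"
proof -
  define m where "m = Inf (S ` W)"
  have "\<exists>u. u \<in> W \<and> S u < m + 1 / Suc n" for n
  proof -
    have "Inf (S ` W) < m + 1 / Suc n" by (simp add: m_def)
    with cInf_lessD[of "S ` W"] assms show ?thesis by blast
  qed
  then obtain u where u: "\<And>n. u n \<in> W" "\<And>n. S (u n) < m + 1 / Suc n" by metis
  have m_le: "m \<le> S w" if "w \<in> W" for w
    unfolding m_def using that S_bounded_below by (intro cInf_lower) auto
  have "(\<lambda>n. m + 1 / real (Suc n)) \<longlonglongrightarrow> m + 0"
    by (intro tendsto_add tendsto_const) (rule LIMSEQ_Suc[OF lim_1_over_n])
  then have upper: "(\<lambda>n. m + 1 / real (Suc n)) \<longlonglongrightarrow> m" by simp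
  have S_lim: "(\<lambda>n. S (u n)) \<longlonglongrightarrow> m"
    by (rule real_tendsto_sandwich[OF _ _ tendsto_const upper])
       (intro always_eventually allI m_le u less_imp_le[OF u(2)])+
  obtain r v where r: "strict_mono r" and v: "v \<in> W"
    and lim: "\<And>t. t \<in> horizon q \<Longrightarrow> (\<lambda>n. u (r n) t) \<longlonglongrightarrow> v t"
    using W_sequentially_compact[of u, OF u(1)] by blast
  have "(\<lambda>n. S (u (r n))) \<longlonglongrightarrow> S v"
    by (rule S_continuous[OF u(1) v lim])
  moreover have "(\<lambda>n. S (u (r n))) \<longlonglongrightarrow> m"
    using LIMSEQ_subseq_LIMSEQ[OF S_lim r] by (simp add: o_def)
  ultimately have "S v = m" by (rule LIMSEQ_unique)
  then show ?thesis
    using v m_le unfolding is_arg_min_def by (metis not_less)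
qed

section \<open>Strict monotonicity and improvement of slack functions\<close>

text \<open>Raising the speed lowers both terms of the cost: the squared deficit from
  \<open>vmax\<close> and the remaining distance. Strictness comes from the first term alone, on an
  interval next to \<open>t0\<close> where continuity keeps \<open>v < w\<close> and the density is
  positive.\<close>

lemma S_strict_antimono:
  assumes v: "v \<in> W" and w: "w \<in> W" and le: "\<And>t. t \<in> horizon q \<Longrightarrow> v t \<le> w t"
    and t0: "t0 \<in> horizon q" "v t0 < w t0"
  shows "S w < S v"
proof -
  have ext_le: "ext v t \<le> ext w t" for t
    using le by (auto simp: ext_def split: split_indicator)
  have pos_le: "position v t \<le> position w t" for t
    unfolding position_def
    by (rule integral_mono[OF position_integrable[OF v] position_integrable[OF w]])
       (use ext_le in \<open>auto split: split_indicator\<close>)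
  \<comment> \<open>The position term is dropped: it contributes
    \<open>(position w t - position v t) / vmax\<close>, which is nonnegative.\<close>
  have cost: "cost v t - cost w t \<ge> ((vmax - ext v t)\<^sup>2 - (vmax - ext w t)\<^sup>2) / (2 * \<alpha> * vmax)" for t
    using divide_right_mono[OF pos_le[of t], of vmax] vmax_pos
    by (simp add: cost_def k_cost_def diff_divide_distrib right_diff_distrib)
  have sq: "(vmax - ext w t)\<^sup>2 \<le> (vmax - ext v t)\<^sup>2" for t
    using ext_le[of t] ext_bounds[OF w, of t] by (intro power_mono) auto
  define g where "g t = cost v t * f t - cost w t * f t" for t
  have g_int: "integrable lborel g"
    unfolding g_def by (intro Bochner_Integration.integrable_diff cost_integrable v w)
  have g_nonneg: "0 \<le> g t" for t
  proof -
    have "0 \<le> ((vmax - ext v t)\<^sup>2 - (vmax - ext w t)\<^sup>2) / (2 * \<alpha> * vmax)"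
      using sq \<alpha>_pos vmax_pos by (intro divide_nonneg_pos) auto
    also note cost[of t]
    finally show ?thesis
      using f_nonneg[of t] unfolding g_def left_diff_distrib[symmetric] by (rule mult_nonneg_nonneg)
  qed
  have g_pos: "0 < g t" if "t \<in> horizon q" "v t < w t" for t
  proof -
    have "(vmax - ext w t)\<^sup>2 < (vmax - ext v t)\<^sup>2"
      using that W_range[OF w that(1)] by (intro power_strict_mono) (auto simp: ext_def)
    then have "0 < ((vmax - ext v t)\<^sup>2 - (vmax - ext w t)\<^sup>2) / (2 * \<alpha> * vmax)"
      using \<alpha>_pos vmax_pos by (intro divide_pos_pos) auto
    also note cost[of t]
    finally show ?thesis
      using f_pos[OF that(1)] unfolding g_def left_diff_distrib[symmetric] by (rule mult_pos_pos)
  qed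
  have cont: "continuous_on (horizon q) (\<lambda>t. w t - v t)"
    using v w lipschitz_ab_imp_lipschitz_on[OF _ \<alpha>_pos \<beta>_pos]
    by (intro continuous_on_diff lipschitz_on_continuous_on) (auto simp: in_W_iff)
  obtain e where e: "e > 0" and near: "\<And>t. t \<in> horizon q \<Longrightarrow> \<bar>t - t0\<bar> < e \<Longrightarrow> v t < w t"
  proof -
    have "0 < w t0 - v t0" using t0 by simp
    then obtain e where "e > 0"
      and e: "\<forall>t\<in>horizon q. dist t t0 < e \<longrightarrow> dist (w t - v t) (w t0 - v t0) < w t0 - v t0"
      using cont t0(1) unfolding continuous_on_iff by blast
    then show thesis
      by (intro that[of e]) (auto simp: dist_real_def abs_less_iff)
  qed
  \<comment> \<open>The interval is taken to the right of \<open>t0\<close>, since \<open>t0\<close>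
    could be \<open>0\<close>; \<open>b\<close> keeps it inside the horizon.\<close>
  obtain b where b: "t0 < b" "ereal b < q"
    using t0 ereal_dense2[of "ereal t0" q] by (auto simp: horizon_def)
  define c where "c = min b (t0 + e)"
  have c: "t0 < c" using b e by (simp add: c_def)
  have pos_on: "0 < g t" if "t \<in> {t0<..<c}" for t
  proof (rule g_pos)
    show H: "t \<in> horizon q"
      by (rule horizon_less[of b]) (use that b t0 in \<open>auto simp: c_def horizon_def\<close>)
    show "v t < w t" using near[OF H] that by (simp add: c_def)
  qed
  have "integral\<^sup>L lborel g \<noteq> 0"
  proof
    assume "integral\<^sup>L lborel g = 0"
    then have "AE t in lborel. g t = 0"
      using integral_nonneg_eq_0_iff_AE[OF g_int] g_nonneg by simp
    then have "AE t in lborel. t \<notin> {t0<..<c}"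
      by eventually_elim (metis pos_on less_irrefl)
    then have "emeasure lborel {t0<..<c} = 0"
      by (subst (asm) AE_iff_measurable[of "{t0<..<c}"]) auto
    then show False using c by (simp add: ennreal_eq_0_iff)
  qed
  then have "0 < integral\<^sup>L lborel g"
    using integral_nonneg_AE[of g lborel] g_nonneg by (simp add: order_less_le)
  then show ?thesis
    unfolding S_eq_integral_cost[OF v] S_eq_integral_cost[OF w] g_def
    using Bochner_Integration.integral_diff[OF cost_integrable[OF v] cost_integrable[OF w]] by simp
qed

text \<open>The peak \<open>p\<close> exceeds \<open>v\<close> by at most its height
  \<open>\<eta>\<close> above \<open>v t0\<close>, and only on an interval of length
  \<open>l\<close>. Hence \<open>max v p\<close> adds at most \<open>\<eta> * l\<close> to the
  distance, which fits into the slack.\<close>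

lemma W_improvable:
  assumes v: "v \<in> W" and slack: "integral\<^sup>L lborel (ext v) < d"
    and t0: "t0 \<in> horizon q" "v t0 < min vmax (v0 + \<alpha> * t0)"
  shows "\<exists>w\<in>W. S w < S v"
proof -
  \<comment> \<open>Time to climb from \<open>0\<close> to \<open>vmax\<close> with slope
    \<open>\<alpha>\<close> plus time to descend again with slope \<open>-\<beta>\<close>; it bounds
    the time during which \<open>p\<close> is positive.\<close>
  define l where "l = vmax / \<alpha> + vmax / \<beta>"
  have l: "l > 0" using \<alpha>_pos \<beta>_pos vmax_pos by (simp add: l_def add_pos_pos)
  \<comment> \<open>The caps keep the peak below \<open>vmax\<close>, its value at time
    \<open>0\<close> below \<open>v0\<close>, and the added distance within the slack.\<close>
  define \<eta> where "\<eta> = min (min vmax (v0 + \<alpha> * t0) - v t0) ((d - integral\<^sup>L lborel (ext v)) / l)"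
  have "\<eta> \<le> min vmax (v0 + \<alpha> * t0) - v t0" "\<eta> \<le> (d - integral\<^sup>L lborel (ext v)) / l"
    by (simp_all only: \<eta>_def min.cobounded1 min.cobounded2)
  moreover have "0 < \<eta>"
    using t0(2) slack l by (simp add: \<eta>_def)
  ultimately have \<eta>: "0 < \<eta>" "v t0 + \<eta> \<le> vmax" "v t0 + \<eta> \<le> v0 + \<alpha> * t0"
    and \<eta>_l: "\<eta> * l \<le> d - integral\<^sup>L lborel (ext v)"
    using l by (auto simp: pos_le_divide_eq)
  define p where "p t = v t0 + \<eta> - \<beta> * max 0 (t - t0) - \<alpha> * max 0 (t0 - t)" for t
  define w where "w t = max (v t) (p t)" for t
  have lip_v: "lipschitz_ab \<alpha> \<beta> q v" using v by (simp add: in_W_iff)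
  have p_lip: "- \<beta> * (t - s) \<le> p t - p s \<and> p t - p s \<le> \<alpha> * (t - s)" if "s \<le> t" for s t
  proof -
    have "\<beta> * max 0 (s - t0) \<le> \<beta> * max 0 (t - t0)" "\<beta> * (max 0 (t - t0) - max 0 (s - t0)) \<le> \<beta> * (t - s)"
      "\<alpha> * max 0 (t0 - t) \<le> \<alpha> * max 0 (t0 - s)" "\<alpha> * (max 0 (t0 - s) - max 0 (t0 - t)) \<le> \<alpha> * (t - s)"
      using that \<alpha>_pos \<beta>_pos by (intro mult_left_mono; auto)+
    then show ?thesis
      unfolding p_def right_diff_distrib by linarith
  qed
  have p_le: "p t \<le> v t0 + \<eta>" for t
  proof -
    have "0 \<le> \<beta> * max 0 (t - t0)" "0 \<le> \<alpha> * max 0 (t0 - t)"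
      using \<alpha>_pos \<beta>_pos by auto
    then show ?thesis unfolding p_def by linarith
  qed
  \<comment> \<open>Moving away from \<open>t0\<close> in either direction, \<open>v\<close> falls
    at most as fast as \<open>p\<close>: forward by the slope bound \<open>-\<beta>\<close>,
    backward by \<open>\<alpha>\<close>.\<close>
  have p_v: "p t \<le> v t + \<eta>" if "t \<in> horizon q" for t
  proof (cases "t \<le> t0")
    case True
    then have "v t0 - v t \<le> \<alpha> * (t0 - t)"
      using lip_v that t0 by (auto simp: lipschitz_ab_def horizon_def)
    then show ?thesis using True by (simp add: p_def max_def)
  next
    case False
    then have "- \<beta> * (t - t0) \<le> v t - v t0"
      using lip_v that t0 by (auto simp: lipschitz_ab_def horizon_def)
    then show ?thesis using False by (simp add: p_def max_def)
  qed
  have p_neg: "p t \<le> 0" if "t \<notin> {t0 - vmax / \<alpha>..t0 + vmax / \<beta>}" for t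
  proof (cases "t \<le> t0")
    case True
    then have "vmax / \<alpha> < t0 - t"
      using that divide_pos_pos[OF vmax_pos \<beta>_pos] by auto
    then have "vmax < \<alpha> * (t0 - t)"
      using \<alpha>_pos by (simp add: pos_divide_less_eq mult.commute)
    moreover have "p t = v t0 + \<eta> - \<alpha> * (t0 - t)"
      using True by (simp add: p_def max_absorb1 max_absorb2)
    ultimately show ?thesis using \<eta>(2) by linarith
  next
    case False
    then have "vmax / \<beta> < t - t0"
      using that divide_pos_pos[OF vmax_pos \<alpha>_pos] by auto
    then have "vmax < \<beta> * (t - t0)"
      using \<beta>_pos by (simp add: pos_divide_less_eq mult.commute)
    moreover have "p t = v t0 + \<eta> - \<beta> * (t - t0)"
      using False by (simp add: p_def max_absorb1 max_absorb2)
    ultimately show ?thesis using \<eta>(2) by linarith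
  qed
  \<comment> \<open>Off the interval \<open>p \<le> 0 \<le> v\<close>, so \<open>w\<close> agrees
    with \<open>v\<close> there.\<close>
  have w_ext: "ext w t \<le> ext v t + indicator {t0 - vmax / \<alpha>..t0 + vmax / \<beta>} t *\<^sub>R \<eta>" for t
    using p_v[of t] p_neg[of t] W_range[OF v, of t] \<eta>(1)
    by (auto simp: ext_def w_def max_def split: split_indicator)
  have bump: "has_bochner_integral lborel (\<lambda>t. indicator {t0 - vmax / \<alpha>..t0 + vmax / \<beta>} t *\<^sub>R \<eta>)
      (measure lborel {t0 - vmax / \<alpha>..t0 + vmax / \<beta>} *\<^sub>R \<eta>)"
    by (rule has_bochner_integral_indicator) (auto simp: emeasure_lborel_Icc_eq)
  have meas: "measure lborel {t0 - vmax / \<alpha>..t0 + vmax / \<beta>} = l"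
    using l by (simp add: l_def)
  have "restrict w (horizon q) \<in> W"
  proof (rule W_restrictI)
    show "lipschitz_ab \<alpha> \<beta> q w"
      unfolding w_def using p_lip by (intro lipschitz_ab_max lip_v) (auto simp: lipschitz_ab_def)
    show "0 \<le> w t \<and> w t \<le> vmax" if "t \<in> horizon q" for t
      using W_range[OF v that] p_le[of t] \<eta>(2) by (auto simp: w_def)
    have "0 \<le> t0" using t0 by (simp add: horizon_def)
    then have "p 0 \<le> v0" using \<eta>(3) by (simp add: p_def)
    then show "w 0 = v0" using v by (simp add: w_def in_W_iff)
    show "integrable lborel (\<lambda>t. ext v t + indicator {t0 - vmax / \<alpha>..t0 + vmax / \<beta>} t *\<^sub>R \<eta>)"
      by (intro Bochner_Integration.integrable_add ext_integrable[OF v] integrable.intros[OF bump])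
    show "(\<integral>t. ext v t + indicator {t0 - vmax / \<alpha>..t0 + vmax / \<beta>} t *\<^sub>R \<eta> \<partial>lborel) \<le> d"
      using Bochner_Integration.integral_add[OF ext_integrable[OF v] integrable.intros[OF bump]]
        has_bochner_integral_integral_eq[OF bump] meas \<eta>_l by (simp add: mult.commute)
  qed (rule w_ext)
  moreover have "S (restrict w (horizon q)) < S v"
    by (rule S_strict_antimono[OF v calculation _ t0(1)]) (use t0(1) \<eta>(1) in \<open>auto simp: w_def p_def\<close>)
  ultimately show ?thesis by blast
qed

section \<open>Extreme profiles and the bounds on \<open>d\<close>\<close>

text \<open>Braking at rate \<open>\<beta>\<close> to a standstill is the pointwise smallest
  profile. The lower bounds on \<open>d\<close> are its distance when it stops by time
  \<open>q\<close> and when the horizon ends first.\<close>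

lemma W_nonempty:
  assumes long: "q \<ge> ereal (v0 / \<beta>) \<Longrightarrow> d \<ge> v0\<^sup>2 / (2 * \<beta>)"
    and short: "q < ereal (v0 / \<beta>) \<Longrightarrow> d \<ge> real_of_ereal q * (v0 - real_of_ereal q * \<beta> / 2)"
  shows "W \<noteq> {}"
proof -
  define v where "v t = max 0 (v0 - \<beta> * t)" for t
  \<comment> \<open>\<open>T\<close> is the stopping time or the end of the horizon, whichever is
    earlier. The profile is affine up to \<open>T\<close> and \<open>ext v\<close> vanishes
    afterwards.\<close>
  obtain T where T: "0 \<le> T" "T * (v0 + T * - \<beta> / 2) \<le> d"
    and ext_le: "\<And>t. ext v t \<le> (v0 + - \<beta> * t) * indicator {0..T} t"
  proof (cases "q \<ge> ereal (v0 / \<beta>)")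
    case True
    show thesis
    proof (rule that[of "v0 / \<beta>"])
      show "v0 / \<beta> * (v0 + v0 / \<beta> * - \<beta> / 2) \<le> d"
        using long[OF True] \<beta>_pos by (simp add: field_simps power2_eq_square)
      show "ext v t \<le> (v0 + - \<beta> * t) * indicator {0..v0 / \<beta>} t" for t
        using \<beta>_pos by (auto simp: ext_def v_def horizon_def field_simps split: split_indicator)
    qed (use v0_nonneg \<beta>_pos in simp)
  next
    case False
    then obtain q' where q': "q = ereal q'" using q_pos by (cases q) auto
    show thesis
    proof (rule that[of q'])
      show "q' * (v0 + q' * - \<beta> / 2) \<le> d" using short False q' by simp
      show "ext v t \<le> (v0 + - \<beta> * t) * indicator {0..q'} t" for t
      proof -
        have "\<beta> * t \<le> v0" if "t \<le> q'"
        proof -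
          have "t \<le> v0 / \<beta>" using False that q' by simp
          then show ?thesis using \<beta>_pos by (simp add: field_simps)
        qed
        moreover have "t \<in> horizon q \<Longrightarrow> 0 \<le> t \<and> t \<le> q'"
          using q' by (simp add: horizon_def)
        ultimately show ?thesis
          by (auto simp: ext_def v_def split: split_indicator)
      qed
    qed (use q' q_pos in simp)
  qed
  have lip: "lipschitz_ab \<alpha> \<beta> q v"
    unfolding lipschitz_ab_def
  proof (intro allI impI)
    fix s t assume st: "0 \<le> s \<and> s \<le> t \<and> ereal t < q"
    then have "\<beta> * s \<le> \<beta> * t" "0 \<le> \<alpha> * (t - s)" using \<alpha>_pos \<beta>_pos by auto
    then show "- \<beta> * (t - s) \<le> v t - v s \<and> v t - v s \<le> \<alpha> * (t - s)"
      by (auto simp: v_def max_def right_diff_distrib)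
  qed
  have "restrict v (horizon q) \<in> W"
  proof (rule W_restrictI[OF lip _ _ _ ext_le])
    show "0 \<le> v t \<and> v t \<le> vmax" if "t \<in> horizon q" for t
    proof -
      have "0 \<le> \<beta> * t" using that \<beta>_pos by (simp add: horizon_def)
      then show ?thesis using v0_le vmax_pos by (simp add: v_def)
    qed
    show "v 0 = v0" using v0_nonneg by (simp add: v_def)
  qed (use has_bochner_integral_affine[OF T(1), of v0 "- \<beta>"] T(2) in
      \<open>auto simp: has_bochner_integral_iff\<close>)
  then show ?thesis by blast
qed

text \<open>Otherwise \<open>v\<close> dominates the profile of full acceleration followed by
  cruising at \<open>vmax\<close>, whose distance exceeds \<open>d\<close> by the upper bounds on
  \<open>d\<close>.\<close>

lemma not_top_speed:
  assumes v: "v \<in> W"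
    and short: "q \<le> ereal ((vmax - v0) / \<alpha>) \<Longrightarrow>
           d < real_of_ereal q * (v0 + real_of_ereal q * \<alpha> / 2)"
    and long: "q \<ge> ereal ((vmax - v0) / \<alpha>) \<Longrightarrow>
           ereal d < ereal ((vmax - v0) * (vmax + v0) / (2 * \<alpha>))
                       + ereal vmax * (q - ereal ((vmax - v0) / \<alpha>))"
  shows "\<exists>t\<in>horizon q. v t < min vmax (v0 + \<alpha> * t)"
proof (rule ccontr)
  assume "\<not> ?thesis"
  then have ge: "min vmax (v0 + \<alpha> * t) \<le> v t" if "t \<in> horizon q" for t
    using that by force
  define top where "top t = min vmax (v0 + \<alpha> * t)" for t
  \<comment> \<open>A finite time \<open>T\<close> by which the top profile has covered more than
    \<open>d\<close>; it equals \<open>q\<close> when \<open>q\<close> is finite.\<close>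
  obtain T I where T: "0 \<le> T" "ereal T \<le> q" "d < I"
    and int: "has_bochner_integral lborel (\<lambda>t. top t * indicator {0..T} t) I"
  proof (cases "q \<le> ereal ((vmax - v0) / \<alpha>)")
    case True
    then obtain q' where q': "q = ereal q'" "0 < q'" "q' \<le> (vmax - v0) / \<alpha>"
      using q_pos by (cases q) auto
    have "has_bochner_integral lborel (\<lambda>t. (v0 + \<alpha> * t) * indicator {0..q'} t) (q' * (v0 + q' * \<alpha> / 2))"
      using q' by (intro has_bochner_integral_affine) simp
    also have "(\<lambda>t. (v0 + \<alpha> * t) * indicator {0..q'} t) = (\<lambda>t. top t * indicator {0..q'} t)"
    proof
      fix t
      have "v0 + \<alpha> * t \<le> vmax" if "t \<le> q'"
        using order_trans[OF that q'(3)] \<alpha>_pos by (simp add: field_simps)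
      then show "(v0 + \<alpha> * t) * indicator {0..q'} t = top t * indicator {0..q'} t"
        by (auto simp: top_def split: split_indicator)
    qed
    finally show thesis using short[OF True] q' by (intro that[of q']) auto
  next
    case False
    define \<tau> where "\<tau> = (vmax - v0) / \<alpha>"
    have \<tau>: "0 \<le> \<tau>" using v0_le \<alpha>_pos by (simp add: \<tau>_def)
    let ?I = "\<lambda>T. (vmax - v0) * (vmax + v0) / (2 * \<alpha>) + vmax * (T - \<tau>)"
    obtain T where T: "\<tau> \<le> T" "ereal T \<le> q" "d < ?I T"
    proof (cases q)
      case (real q')
      then show thesis using False long \<tau> by (intro that[of q']) (auto simp: \<tau>_def)
    next
      case PInf
      have "0 \<le> (vmax - v0) * (vmax + v0) / (2 * \<alpha>)"
        using v0_le v0_nonneg \<alpha>_pos by simp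
      \<comment> \<open>Cruising for time \<open>(\<bar>d\<bar> + 1) / vmax\<close> alone covers
        \<open>\<bar>d\<bar> + 1\<close>.\<close>
      then have "d < ?I (\<tau> + (\<bar>d\<bar> + 1) / vmax)"
        using vmax_pos by simp
      then show thesis using PInf vmax_pos by (intro that[of "\<tau> + (\<bar>d\<bar> + 1) / vmax"]) auto
    qed (use q_pos in auto)
    then show thesis
      using has_bochner_integral_min_affine[OF \<alpha>_pos v0_le, of T] \<tau>
      by (intro that[of T "?I T"]) (auto simp: top_def \<tau>_def)
  qed
  have "I = (\<integral>t. top t * indicator {0..T} t \<partial>lborel)"
    using int by (simp add: has_bochner_integral_iff)
  \<comment> \<open>The endpoint is removed because \<open>T\<close> may equal \<open>q\<close>,
    which lies outside the horizon.\<close>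
  also have "\<dots> = (\<integral>t. top t * indicator {0..<T} t \<partial>lborel)"
    by (rule integral_discrete_difference[where X="{T}"]) (auto split: split_indicator)
  also have "\<dots> \<le> integral\<^sup>L lborel (ext v)"
  proof (rule integral_mono_AE'[OF ext_integrable[OF v]])
    show "AE t in lborel. top t * indicator {0..<T} t \<le> ext v t"
    proof (rule AE_I2)
      fix t
      have "t \<in> horizon q" if "t \<in> {0..<T}"
        using that T(2) by (auto simp: horizon_def intro: less_le_trans[of "ereal t" "ereal T" q])
      then show "top t * indicator {0..<T} t \<le> ext v t"
        using ge[of t] ext_bounds(1)[OF v, of t] by (auto simp: top_def ext_def split: split_indicator)
    qed
    show "AE t in lborel. 0 \<le> ext v t" using ext_bounds(1)[OF v] by simp
  qed
  also have "\<dots> \<le> d" using v by (simp add: in_W_iff)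
  finally show False using T by simp
qed

end

section \<open>Existence of minimisers and exhaustion of the distance\<close>

theorem theorem3p7:
  fixes \<alpha> \<beta> vmax v0 d L :: real
    and q :: ereal
    and M :: "'w measure"
    and T :: "'w \<Rightarrow> real"
    and f :: "real \<Rightarrow> real"
  assumes "\<alpha> > 0" and "\<beta> > 0" and "vmax > 0"
    and "0 \<le> v0" and "v0 \<le> vmax" and "d > 0"
    and "L \<ge> vmax\<^sup>2 / (2 * \<alpha>)"
    and "q > 0"
    and "prob_space M"
    and "\<forall>\<omega>\<in>space M. T \<omega> \<ge> 0"
    and "integrable M T"
    and "distributed M lborel T (\<lambda>t. ennreal (f t))"
    and "\<forall>t. t \<notin> horizon q \<longrightarrow> f t = 0"
    and "\<exists>B. \<forall>t. f t \<le> B"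
    and "\<forall>t\<in>horizon q. f t > 0"
    and "antimono_on (horizon q) f"
    and "q \<ge> ereal (v0 / \<beta>) \<Longrightarrow> d \<ge> v0\<^sup>2 / (2 * \<beta>)"
    and "q < ereal (v0 / \<beta>) \<Longrightarrow>
           d \<ge> real_of_ereal q * (v0 - real_of_ereal q * \<beta> / 2)"
    and "q \<le> ereal ((vmax - v0) / \<alpha>) \<Longrightarrow>
           d < real_of_ereal q * (v0 + real_of_ereal q * \<alpha> / 2)"
    and "q \<ge> ereal ((vmax - v0) / \<alpha>) \<Longrightarrow>
           ereal d < ereal ((vmax - v0) * (vmax + v0) / (2 * \<alpha>))
                       + ereal vmax * (q - ereal ((vmax - v0) / \<alpha>))"
  shows "(\<exists>v. is_arg_min (S_fun \<alpha> vmax L q f) (\<lambda>v. v \<in> W_set \<alpha> \<beta> vmax v0 d q) v) \<and>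
         (\<forall>v. is_arg_min (S_fun \<alpha> vmax L q f) (\<lambda>v. v \<in> W_set \<alpha> \<beta> vmax v0 d q) v \<longrightarrow>
              (LBINT t=0..q. v t) = d \<and> v \<in> V_set \<alpha> \<beta> vmax v0 d q)"
proof -
  have f_nonneg: "0 \<le> f t" for t
    using assms(13,15) by (cases "t \<in> horizon q") (auto intro: less_imp_le)
  interpret prob_space M by fact
  interpret speed_problem \<alpha> \<beta> vmax v0 d L q f
  proof
    \<comment> \<open>Integrability transfers from the probability space through the density: the
      constant \<open>1\<close> gives \<open>f\<close> itself, and the identity turns finite mean
      into the first moment.\<close>
    show "integrable lborel f"
      using distributed_integrable[OF assms(12), of "\<lambda>_. 1"] f_nonneg by simp
    show "integrable lborel (\<lambda>t. t * f t)"
      using distributed_integrable[OF assms(12), of "\<lambda>t. t"] f_nonneg assms(11)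
      by (simp add: mult.commute)
  qed (use assms in auto)
  have "(LBINT t=0..q. v t) = d \<and> v \<in> V_set \<alpha> \<beta> vmax v0 d q"
    if "is_arg_min S (\<lambda>v. v \<in> W) v" for v
  proof -
    have v: "v \<in> W" and min: "\<And>w. w \<in> W \<Longrightarrow> \<not> S w < S v"
      using that by (auto simp: is_arg_min_def)
    obtain t0 where "t0 \<in> horizon q" "v t0 < min vmax (v0 + \<alpha> * t0)"
      using not_top_speed[OF v assms(19,20)] by blast
    then have "\<not> integral\<^sup>L lborel (ext v) < d"
      using W_improvable[OF v] min by blast
    then have "(LBINT t=0..q. v t) = d"
      using v by (simp add: in_W_iff interval_integral_eq ext_def[abs_def])
    with v show ?thesis by (simp add: V_set_def)
  qed
  with minimiser_exists[OF W_nonempty[OF assms(17,18)]] show ?thesis by blast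
qed

end
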